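(* Let $\lambda>0$. The probability measure $\mu=\Pi^{1}_{0,\lambda}$ can be regarded as the conditionally free Poisson distribution with respect to the reference measure $\nu$ of the semicircle law with mean $\lambda$ and variance $\lambda$.
   Context: For $\lambda>0$ and $s,t\in(0,1]$, $\Pi^{s}_{t,\lambda}$ denotes the orthogonalizing probability measure on $\mathbb{R}$ of the polynomials given by $C_0(x)=1$, $C_1(x)=x-\lambda$, $C_{n+1}(x)=\bigl(x-(\lambda s^n+t^{n-1})\bigr)C_n(x)-\lambda s^{n-1}C_{n-1}(x)$ for $n\ge1$. The measure $\Pi^{1}_{0,\lambda}$ is the case $s=1$, $t\to0$, that is, the orthogonalizing probability measure of the polynomials determined by $C_0(x)=1$, $C_1(x)=x-\lambda$, $C_2(x)=\bigl(x-(\lambda+1)\bigr)C_1(x)-\lambda C_0(x)$, and $C_{n+1}(x)=(x-\lambda)C_n(x)-\lambda C_{n-1}(x)$ for $n\ge2$. For a probability measure $\mu$ on $\mathbb{R}$ its Cauchy transform is $G_\mu(z)=\int_{\mathbb{R}}\frac{d\mu(x)}{z-x}$. For a pair $(\mu,\nu)$ of compactly supported probability measures on $\mathbb{R}$, the free cumulant series $R_\nu$ (Voiculescu's $R$-transform) and the conditionally free cumulant series $R_{(\mu,\nu)}$ are the complex functions satisfying $$\frac{1}{G_\nu(z)}=z-R_\nu\bigl(G_\nu(z)\bigr),\qquad \frac{1}{G_\mu(z)}=z-R_{(\mu,\nu)}\bigl(G_\nu(z)\bigr).$$ The conditionally free convolution of pairs of measures is the operation under which both $R_\nu$ and $R_{(\mu,\nu)}$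 are additive. The semicircle law with mean $\lambda$ and variance $\lambda$ is the measure $\nu$ with $R_\nu(z)=\lambda+\lambda z$. The name "conditionally free Poisson distribution with respect to the reference measure $\nu$" is used, without a separate formal definition, in the sense of the characterization of Poisson distributions by constant cumulants of all orders, applied here to the conditionally free cumulants of the pair $(\mu,\nu)$, i.e. the coefficients of $R_{(\mu,\nu)}$. *)

theory Defs
  imports "HOL-Probability.Probability" "HOL-Computational_Algebra.Computational_Algebra"
begin

text \<open>The polynomials \<open>C\<^sub>n\<close>. Since \<open>0 ^ 0 = 1\<close>, the limit \<open>t \<rightarrow> 0\<close> of the coefficients
  is their value at \<open>t = 0\<close>.\<close>

fun charlier :: "real \<Rightarrow> real \<Rightarrow> real \<Rightarrow> nat \<Rightarrow> real poly" where
  "charlier s t l 0 = 1"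
| "charlier s t l (Suc 0) = [:- l, 1:]"
| "charlier s t l (Suc (Suc n)) =
     [:- (l * s ^ Suc n + t ^ n), 1:] * charlier s t l (Suc n) - smult (l * s ^ n) (charlier s t l n)"

lemma charlier_1_0:
  "charlier 1 0 l 0 = 1"
  "charlier 1 0 l 1 = [:- l, 1:]"
  "charlier 1 0 l 2 = [:- (l + 1), 1:] * charlier 1 0 l 1 - smult l (charlier 1 0 l 0)"
  "n \<ge> 2 \<Longrightarrow> charlier 1 0 l (n + 1) = [:- l, 1:] * charlier 1 0 l n - smult l (charlier 1 0 l (n - 1))"
proof -
  assume "n \<ge> 2"
  then obtain k where "n = Suc (Suc k)"
    by (metis add_2_eq_Suc le_Suc_ex)
  then show "charlier 1 0 l (n + 1) = [:- l, 1:] * charlier 1 0 l n - smult l (charlier 1 0 l (n - 1))"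
    by simp
qed (simp_all add: numeral_2_eq_2)

definition orthogonalizing_probability_measure :: "(nat \<Rightarrow> real poly) \<Rightarrow> real measure \<Rightarrow> bool" where
  "orthogonalizing_probability_measure P \<mu> \<longleftrightarrow>
     real_distribution \<mu> \<and>
     (\<forall>m n. integrable \<mu> (\<lambda>x. poly (P m) x * poly (P n) x)) \<and>
     (\<forall>m n. m \<noteq> n \<longrightarrow> (LINT x|\<mu>. poly (P m) x * poly (P n) x) = 0)"

definition compactly_supported_distribution :: "real measure \<Rightarrow> bool" where
  "compactly_supported_distribution \<mu> \<longleftrightarrow>
     real_distribution \<mu> \<and> (\<exists>K. compact K \<and> (AE x in \<mu>. x \<in> K))"

definition cauchy_transform :: "real measure \<Rightarrow> complex \<Rightarrow> complex" where
  "cauchy_transform \<mu> z = (LINT x|\<mu>. 1 / (z - complex_of_real x))"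

text \<open>The cumulant series are power series around 0 with positive radius of convergence. Since the
  Cauchy transform of a compactly supported measure vanishes at infinity, their defining equations
  are required for all \<open>z\<close> of large modulus; this determines them uniquely. The cumulant of order
  \<open>n \<ge> 1\<close> is the coefficient of index \<open>n - 1\<close>.\<close>

definition free_cumulant_series :: "real measure \<Rightarrow> complex fps \<Rightarrow> bool" where
  "free_cumulant_series \<nu> R \<longleftrightarrow>
     compactly_supported_distribution \<nu> \<and> fps_conv_radius R > 0 \<and>
     (\<forall>\<^sub>F z in at_infinity.
        1 / cauchy_transform \<nu> z = z - eval_fps R (cauchy_transform \<nu> z))"

definition cfree_cumulant_series :: "real measure \<Rightarrow> real measure \<Rightarrow> complex fps \<Rightarrow> bool" where
  "cfree_cumulant_series \<mu> \<nu> R \<longleftrightarrow>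
     compactly_supported_distribution \<mu> \<and> compactly_supported_distribution \<nu> \<and>
     fps_conv_radius R > 0 \<and>
     (\<forall>\<^sub>F z in at_infinity.
        1 / cauchy_transform \<mu> z = z - eval_fps R (cauchy_transform \<nu> z))"

definition semicircle_law :: "real \<Rightarrow> real \<Rightarrow> real measure \<Rightarrow> bool" where
  "semicircle_law m v \<nu> \<longleftrightarrow>
     free_cumulant_series \<nu> (fps_const (complex_of_real m) + fps_const (complex_of_real v) * fps_X)"

definition cfree_poisson :: "real \<Rightarrow> real measure \<Rightarrow> real measure \<Rightarrow> bool" where
  "cfree_poisson l \<mu> \<nu> \<longleftrightarrow>
     (\<exists>R. cfree_cumulant_series \<mu> \<nu> R \<and> (\<forall>n\<ge>1. fps_nth R (n - 1) = complex_of_real l))"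

end

theory Submission imports Defs begin

text \<open>Let \<open>Q\<^sub>k(z) = \<integral> C\<^sub>k(x) / (z - x) d\<mu>(x)\<close> be the functions of the second kind. Boundedness of the
  recurrence coefficients bounds the moments of \<open>\<mu>\<close> geometrically, so \<open>\<mu>\<close> has compact support and
  \<open>Q\<^sub>k(z)\<close> grows at most geometrically in \<open>k\<close>, at a rate independent of \<open>z\<close>. For \<open>k \<ge> 1\<close> they satisfy the
  recurrence \<open>Q\<^sub>k\<^sub>+\<^sub>2 = (z - \<lambda>) Q\<^sub>k\<^sub>+\<^sub>1 - \<lambda> Q\<^sub>k\<close>, whose characteristic roots are \<open>\<lambda> G\<close> and \<open>1 / G\<close> where
  \<open>G = G\<^sub>\<nu>(z)\<close>. As \<open>1 / G\<close> is large for large \<open>z\<close>, the growth bound leaves only the first root: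
  \<open>Q\<^sub>2 = \<lambda> G Q\<^sub>1\<close>. The first two steps of the recurrence then give \<open>1 / Q\<^sub>0 = z - \<lambda> / (1 - G)\<close>, and
  \<open>Q\<^sub>0 = G\<^sub>\<mu>\<close>.\<close>

section \<open>Measures of bounded support and their Stieltjes integrals\<close>

text \<open>Markov's inequality applied to the nonnegative functions \<open>x ^ (2 * n)\<close>
  bounds the tail beyond \<open>c\<close> by \<open>(r / c) ^ (2 * n)\<close>, which tends to
  0.\<close>

lemma real_distribution_AE_bounded:
  fixes \<mu> :: "real measure"
  assumes "real_distribution \<mu>"
    and int: "\<And>n. integrable \<mu> (\<lambda>x. x ^ n)"
    and bound: "\<And>n. \<bar>LINT x|\<mu>. x ^ n\<bar> \<le> r ^ n"
    and r: "0 < r" "r < c"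
  shows "AE x in \<mu>. \<bar>x\<bar> < c"
proof -
  interpret real_distribution \<mu> by fact
  let ?A = "{x \<in> space \<mu>. c \<le> \<bar>x\<bar>}"
  have le: "prob ?A \<le> ((r / c)\<^sup>2) ^ n" for n
  proof -
    have "prob ?A \<le> prob {x \<in> space \<mu>. c ^ (2 * n) \<le> x ^ (2 * n)}"
    proof (rule finite_measure_mono)
      show "?A \<subseteq> {x \<in> space \<mu>. c ^ (2 * n) \<le> x ^ (2 * n)}"
      proof safe
        fix x :: real assume "c \<le> \<bar>x\<bar>"
        then have "c ^ (2 * n) \<le> \<bar>x\<bar> ^ (2 * n)"
          using r by (intro power_mono) auto
        then show "c ^ (2 * n) \<le> x ^ (2 * n)"
          by (simp add: power_even_abs)
      qed
    qed measurable
    also have "\<dots> \<le> (LINT x|\<mu>. x ^ (2 * n)) / c ^ (2 * n)"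
      using r by (intro integral_Markov_inequality_measure[where A = "{}"] int) auto
    also have "\<dots> \<le> r ^ (2 * n) / c ^ (2 * n)"
      using r abs_le_D1[OF bound[of "2 * n"]] by (intro divide_right_mono) auto
    also have "\<dots> = ((r / c)\<^sup>2) ^ n"
      by (simp add: power_divide power_mult)
    finally show ?thesis .
  qed
  have "(\<lambda>n. ((r / c)\<^sup>2) ^ n) \<longlonglongrightarrow> 0"
    using r by (intro LIMSEQ_power_zero) (simp add: power_less_one_iff abs_square_less_1)
  then have "prob ?A \<le> 0"
    by (rule LIMSEQ_le_const) (use le in auto)
  then have "prob ?A = 0"
    by (simp add: measure_le_0_iff)
  then have "AE x in \<mu>. \<not> c \<le> \<bar>x\<bar>"
    by (subst (asm) prob_eq_0) auto
  then show ?thesis by (simp add: not_le)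
qed

text \<open>Almost everywhere \<open>norm (z - x)\<close> is at least \<open>norm z - B\<close>.
  Since \<open>f\<close> need only be bounded on \<open>[-B, B]\<close>, this covers polynomials as
  well as the constant of the Cauchy transform.\<close>

lemma stieltjes_integral_of_AE_bounded:
  fixes f :: "real \<Rightarrow> real"
  assumes "real_distribution \<mu>" and B: "AE x in \<mu>. \<bar>x\<bar> \<le> B" and z: "norm z > B"
    and f: "f \<in> borel_measurable borel" and fb: "\<And>x. \<bar>x\<bar> \<le> B \<Longrightarrow> \<bar>f x\<bar> \<le> C"
  shows "integrable \<mu> (\<lambda>x. of_real (f x) / (z - complex_of_real x))"
    and "norm (LINT x|\<mu>. of_real (f x) / (z - complex_of_real x)) \<le> C / (norm z - B)"
proof -
  interpret real_distribution \<mu> by fact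
  have bd: "AE x in \<mu>. norm (of_real (f x) / (z - complex_of_real x)) \<le> C / (norm z - B)"
    using B
  proof eventually_elim
    case (elim x)
    have "norm z - B \<le> norm (z - complex_of_real x)"
      using norm_triangle_ineq2[of z "complex_of_real x"] elim by simp
    then show ?case
      using fb[OF elim] z by (simp add: norm_divide frac_le)
  qed
  show int: "integrable \<mu> (\<lambda>x. of_real (f x) / (z - complex_of_real x))"
  proof (rule integrable_const_bound[OF bd])
    have "complex_of_real \<in> borel_measurable borel"
      by (intro borel_measurable_continuous_onI continuous_intros)
    then have "(\<lambda>x. of_real (f x) / (z - complex_of_real x)) \<in> borel_measurable borel"
      using f by (intro borel_measurable_divide borel_measurable_diff borel_measurable_const)
        (auto intro: measurable_compose)
    then show "(\<lambda>x. of_real (f x) / (z - complex_of_real x)) \<in> borel_measurable \<mu>"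
      by (simp add: measurable_cong_sets[OF events_eq_borel refl])
  qed
  have "norm (LINT x|\<mu>. of_real (f x) / (z - complex_of_real x))
      \<le> (LINT x|\<mu>. norm (of_real (f x) / (z - complex_of_real x)))"
    by (rule integral_norm_bound)
  also have "\<dots> \<le> (LINT x|\<mu>. C / (norm z - B))"
    using bd int by (intro integral_mono_AE) auto
  finally show "norm (LINT x|\<mu>. of_real (f x) / (z - complex_of_real x)) \<le> C / (norm z - B)"
    using prob_space by simp
qed

lemma compactly_supported_distribution_iff:
  "compactly_supported_distribution \<mu> \<longleftrightarrow>
     real_distribution \<mu> \<and> (\<exists>B. AE x in \<mu>. \<bar>x\<bar> \<le> B)"
proof
  assume "compactly_supported_distribution \<mu>"
  then obtain K where K: "real_distribution \<mu>" "compact K" "AE x in \<mu>. x \<in> K"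
    by (auto simp: compactly_supported_distribution_def)
  then obtain B where "\<And>x. x \<in> K \<Longrightarrow> \<bar>x\<bar> \<le> B"
    using compact_imp_bounded[of K] by (auto simp: bounded_iff)
  with K show "real_distribution \<mu> \<and> (\<exists>B. AE x in \<mu>. \<bar>x\<bar> \<le> B)"
    by (auto intro!: exI[of _ B] elim: eventually_mono)
next
  assume "real_distribution \<mu> \<and> (\<exists>B. AE x in \<mu>. \<bar>x\<bar> \<le> B)"
  then obtain B where "real_distribution \<mu>" "AE x in \<mu>. \<bar>x\<bar> \<le> B" by blast
  then show "compactly_supported_distribution \<mu>"
    unfolding compactly_supported_distribution_def
    by (auto intro!: exI[of _ "{-B..B}"] elim!: eventually_mono)
qed

lemma cauchy_transform_bound:
  assumes "real_distribution \<mu>" "AE x in \<mu>. \<bar>x\<bar> \<le> B" "norm z > B"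
  shows "norm (cauchy_transform \<mu> z) \<le> 1 / (norm z - B)"
  using stieltjes_integral_of_AE_bounded(2)[OF assms, of "\<lambda>_. 1" 1]
  by (simp add: cauchy_transform_def)

section \<open>Orthogonal polynomials with bounded recurrence coefficients\<close>

text \<open>The junk value \<open>P (0 - 1) = P 0\<close> is harmless because its coefficient \<open>b 0\<close> vanishes.\<close>

locale bounded_orthogonal_recurrence = real_distribution \<mu>
  for \<mu> :: "real measure" +
  fixes P :: "nat \<Rightarrow> real poly" and a b :: "nat \<Rightarrow> real" and r :: real
  assumes orth: "orthogonalizing_probability_measure P \<mu>"
    and P_0: "P 0 = 1"
    and P_Suc: "P (Suc k) = [:- a k, 1:] * P k - smult (b k) (P (k - 1))"
    and b_0: "b 0 = 0"
    and coeff_bound: "1 + \<bar>a k\<bar> + \<bar>b k\<bar> \<le> r"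
begin

lemma r_ge_1: "1 \<le> r"
  using coeff_bound[of 0] by linarith

lemma integrable_P: "integrable \<mu> (poly (P k))"
  using orth[unfolded orthogonalizing_probability_measure_def, THEN conjunct2, THEN conjunct1,
      rule_format, of k 0]
  by (simp add: P_0)

lemma integral_P: "(LINT x|\<mu>. poly (P k) x) = (if k = 0 then 1 else 0)"
proof (cases "k = 0")
  case True
  then show ?thesis using prob_space by (simp add: P_0)
next
  case False
  with orth have "(LINT x|\<mu>. poly (P k) x * poly (P 0) x) = 0"
    unfolding orthogonalizing_probability_measure_def by blast
  with False show ?thesis by (simp add: P_0)
qed

lemma mult_P:
  "x * poly (P k) x = poly (P (Suc k)) x + a k * poly (P k) x + b k * poly (P (k - 1)) x"
  by (simp add: P_Suc algebra_simps)

lemma power_Suc_mult_P: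
  "x ^ Suc n * poly (P k) x = x ^ n * poly (P (Suc k)) x + a k * (x ^ n * poly (P k) x)
     + b k * (x ^ n * poly (P (k - 1)) x)"
proof -
  have "x ^ Suc n * poly (P k) x = x ^ n * (x * poly (P k) x)" by simp
  then show ?thesis by (subst (asm) mult_P) (simp only: algebra_simps)
qed

lemma integrable_power_mult_P: "integrable \<mu> (\<lambda>x. x ^ n * poly (P k) x)"
  by (induction n arbitrary: k) (auto simp: integrable_P power_Suc_mult_P simp del: power_Suc)

text \<open>Each factor \<open>x\<close> is traded for three polynomials of neighbouring index, with
  weights of total modulus at most \<open>r\<close>; without factors the integral is 0 or 1. The
  induction needs all \<open>k\<close>, while the moments are the case \<open>k = 0\<close>.\<close>

lemma moment_bound: "\<bar>LINT x|\<mu>. x ^ n * poly (P k) x\<bar> \<le> r ^ n"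
proof (induction n arbitrary: k)
  case 0
  then show ?case by (simp add: integral_P)
next
  case (Suc n)
  let ?I = "\<lambda>k. LINT x|\<mu>. x ^ n * poly (P k) x"
  have "(LINT x|\<mu>. x ^ Suc n * poly (P k) x) = ?I (Suc k) + a k * ?I k + b k * ?I (k - 1)"
    by (simp add: power_Suc_mult_P integrable_power_mult_P del: power_Suc)
  also have "\<bar>\<dots>\<bar> \<le> \<bar>?I (Suc k)\<bar> + \<bar>a k\<bar> * \<bar>?I k\<bar> + \<bar>b k\<bar> * \<bar>?I (k - 1)\<bar>"
    unfolding abs_mult[symmetric] by linarith
  also have "\<dots> \<le> r ^ n + \<bar>a k\<bar> * r ^ n + \<bar>b k\<bar> * r ^ n"
    by (intro add_mono mult_left_mono Suc) auto
  also have "\<dots> = (1 + \<bar>a k\<bar> + \<bar>b k\<bar>) * r ^ n"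
    by (simp add: algebra_simps)
  also have "\<dots> \<le> r * r ^ n"
    using r_ge_1 by (intro mult_right_mono coeff_bound) auto
  finally show ?case by simp
qed

text \<open>The tail estimate needs a bound strictly above \<open>r\<close>; the factor 2 is a
  convenient choice.\<close>

lemma AE_bounded: "AE x in \<mu>. \<bar>x\<bar> \<le> 2 * r"
proof -
  have "AE x in \<mu>. \<bar>x\<bar> < 2 * r"
    using integrable_power_mult_P[of _ 0] moment_bound[of _ 0] r_ge_1
    by (intro real_distribution_AE_bounded[of \<mu> r]) (auto simp: P_0 real_distribution_axioms)
  then show ?thesis by (auto elim: eventually_mono)
qed

lemma poly_P_bound:
  assumes x: "\<bar>x\<bar> \<le> 2 * r"
  shows "\<bar>poly (P k) x\<bar> \<le> (3 * r) ^ k"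
proof (induction k rule: less_induct)
  case (less k)
  show ?case
  proof (cases k)
    case 0
    then show ?thesis by (simp add: P_0)
  next
    case (Suc j)
    have prev: "\<bar>poly (P (j - 1)) x\<bar> \<le> (3 * r) ^ j"
    proof -
      have "\<bar>poly (P (j - 1)) x\<bar> \<le> (3 * r) ^ (j - 1)" using less Suc by auto
      also have "\<dots> \<le> (3 * r) ^ j" using r_ge_1 by (intro power_increasing) auto
      finally show ?thesis .
    qed
    have "\<bar>poly (P (Suc j)) x\<bar> = \<bar>(x - a j) * poly (P j) x - b j * poly (P (j - 1)) x\<bar>"
      by (simp add: P_Suc algebra_simps)
    also have "\<dots> \<le> \<bar>x - a j\<bar> * \<bar>poly (P j) x\<bar> + \<bar>b j\<bar> * \<bar>poly (P (j - 1)) x\<bar>"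
      unfolding abs_mult[symmetric] by linarith
    also have "\<dots> \<le> \<bar>x - a j\<bar> * (3 * r) ^ j + \<bar>b j\<bar> * (3 * r) ^ j"
      using less Suc prev by (intro add_mono mult_left_mono) auto
    also have "\<dots> = (\<bar>x - a j\<bar> + \<bar>b j\<bar>) * (3 * r) ^ j"
      by (simp add: algebra_simps)
    \<comment> \<open>Here \<open>2 * r\<close> comes from \<open>x\<close>, and the coefficients
      contribute at most another \<open>r\<close>.\<close>
    also have "\<dots> \<le> (3 * r) * (3 * r) ^ j"
      using coeff_bound[of j] x r_ge_1 by (intro mult_right_mono) auto
    finally show ?thesis using Suc by simp
  qed
qed

definition second_kind :: "nat \<Rightarrow> complex \<Rightarrow> complex" where
  "second_kind k z = (LINT x|\<mu>. of_real (poly (P k) x) / (z - complex_of_real x))"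

lemma second_kind_0: "second_kind 0 z = cauchy_transform \<mu> z"
  by (simp add: second_kind_def cauchy_transform_def P_0)

context
  fixes z :: complex
  assumes z: "norm z > 2 * r"
begin

lemma integrable_second_kind:
  "integrable \<mu> (\<lambda>x. of_real (poly (P k) x) / (z - complex_of_real x))"
  by (rule stieltjes_integral_of_AE_bounded(1)[OF _ AE_bounded z _ poly_P_bound])
     (auto simp: real_distribution_axioms intro!: borel_measurable_continuous_onI continuous_intros)

lemma second_kind_bound: "norm (second_kind k z) \<le> (3 * r) ^ k / (norm z - 2 * r)"
  unfolding second_kind_def
  by (rule stieltjes_integral_of_AE_bounded(2)[OF _ AE_bounded z _ poly_P_bound])
     (auto simp: real_distribution_axioms intro!: borel_measurable_continuous_onI continuous_intros)

text \<open>Writing \<open>x - a k\<close> as \<open>(z - a k) - (z - x)\<close> in the recurrence,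
  the second part cancels the denominator and leaves the integral of \<open>P k\<close>, which
  orthogonality to \<open>P 0\<close> makes 0 unless \<open>k = 0\<close>.\<close>

lemma second_kind_Suc:
  "second_kind (Suc k) z = (z - a k) * second_kind k z - b k * second_kind (k - 1) z
     - (if k = 0 then 1 else 0)"
proof -
  let ?q = "\<lambda>k x. of_real (poly (P k) x) / (z - complex_of_real x)"
  have "AE x in \<mu>. ?q (Suc k) x =
      (z - a k) * ?q k x - b k * ?q (k - 1) x - of_real (poly (P k) x)"
    using AE_bounded
  proof eventually_elim
    case (elim x)
    then have w: "z - of_real x \<noteq> 0" using z by auto
    let ?p = "\<lambda>k. complex_of_real (poly (P k) x)"
    have "?p (Suc k) = (z - a k) * ?p k - b k * ?p (k - 1) - (z - of_real x) * ?p k"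
      by (simp add: P_Suc algebra_simps)
    also have "\<dots> / (z - of_real x) = (z - a k) * ?q k x - b k * ?q (k - 1) x - ?p k"
      using w by (simp add: diff_divide_distrib)
    finally show ?case .
  qed
  then have "second_kind (Suc k) z =
      (LINT x|\<mu>. (z - a k) * ?q k x - b k * ?q (k - 1) x - of_real (poly (P k) x))"
    unfolding second_kind_def
    by (intro integral_cong_AE borel_measurable_integrable integrable_second_kind
        Bochner_Integration.integrable_diff integrable_mult_right integrable_of_real integrable_P)
  also have "\<dots> = (z - a k) * second_kind k z - b k * second_kind (k - 1) z
      - of_real (LINT x|\<mu>. poly (P k) x)"
    unfolding second_kind_def
    by (simp only: Bochner_Integration.integral_diff integrable_second_kind integrable_P
        integrable_of_real integrable_mult_right Bochner_Integration.integrable_diff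
        integral_mult_right_zero integral_complex_of_real)
  finally show ?thesis by (simp add: integral_P)
qed

end

end

section \<open>Dominated solutions of a recurrence and evaluation of the cumulant series\<close>

text \<open>The combination \<open>q (Suc k) - u * q k\<close> eliminates the root \<open>u\<close>
  and is geometric with ratio \<open>v\<close>. Growth at a rate \<open>s\<close> below
  \<open>norm v\<close> forces it to vanish.\<close>

lemma recurrence_dominated_solution:
  fixes q :: "nat \<Rightarrow> complex"
  assumes rec: "\<And>k. q (Suc (Suc k)) = (u + v) * q (Suc k) - u * v * q k"
    and bound: "\<And>k. norm (q k) \<le> C * s ^ k"
    and s: "0 \<le> s" "s < norm v"
  shows "q 1 = u * q 0"
proof -
  define d where "d k = q (Suc k) - u * q k" for k
  have d: "d k = v ^ k * d 0" for k
  proof (induction k)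
    case (Suc k)
    have "d (Suc k) = v * d k" by (simp add: d_def rec algebra_simps)
    with Suc show ?case by simp
  qed simp
  have "norm (d 0) \<le> C * (s + norm u) * (s / norm v) ^ k" for k
  proof -
    have "norm v ^ k * norm (d 0) = norm (d k)" by (subst d) (simp add: norm_mult norm_power)
    also have "\<dots> \<le> C * s ^ Suc k + norm u * (C * s ^ k)"
      unfolding d_def using bound[of "Suc k"] mult_left_mono[OF bound[of k], of "norm u"]
      by (intro order.trans[OF norm_triangle_ineq4] add_mono) (auto simp: norm_mult)
    finally have "norm v ^ k * norm (d 0) \<le> C * (s + norm u) * s ^ k"
      by (simp add: algebra_simps)
    moreover have "0 < norm v ^ k" using s by (intro zero_less_power) linarith
    ultimately show ?thesis
      by (simp add: power_divide pos_le_divide_eq mult.commute)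
  qed
  moreover have "(\<lambda>k. C * (s + norm u) * (s / norm v) ^ k) \<longlonglongrightarrow> C * (s + norm u) * 0"
    using s by (intro tendsto_mult_left LIMSEQ_power_zero) (simp add: divide_less_eq)
  ultimately have "norm (d 0) \<le> C * (s + norm u) * 0"
    by (intro LIMSEQ_le_const) auto
  then show ?thesis by (simp add: d_def)
qed

lemma eval_fps_constant_coeffs:
  fixes c z :: complex
  assumes "norm z < 1"
  shows "eval_fps (Abs_fps (\<lambda>_. c)) z = c / (1 - z)"
  using assms by (simp add: eval_fps_def suminf_mult summable_geometric suminf_geometric)

lemma fps_conv_radius_constant_coeffs_pos: "fps_conv_radius (Abs_fps (\<lambda>_. c :: complex)) > 0"
proof -
  have "ereal 1 \<le> conv_radius (\<lambda>_::nat. c)"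
    by (rule conv_radius_geI_ex') (auto intro: summable_mult summable_geometric)
  then show ?thesis
    by (simp add: fps_conv_radius_def less_le_trans[of 0 "ereal 1"])
qed

text \<open>The affine series is the free cumulant series of a semicircle law; its radius of
  convergence is infinite, so \<open>z\<close> is unrestricted.\<close>

lemma eval_fps_affine:
  fixes c d z :: complex
  shows "eval_fps (fps_const c + fps_const d * fps_X) z = c + d * z"
proof -
  have "fps_conv_radius (fps_const d * fps_X :: complex fps) = \<infinity>"
    using fps_conv_radius_mult[of "fps_const d :: complex fps" fps_X] by simp
  then show ?thesis by (simp add: eval_fps_add eval_fps_mult)
qed

section \<open>The conditionally free cumulants of the pair\<close>

theorem proposition6p1:
  fixes l :: real and \<mu> \<nu> :: "real measure"
  assumes "l > 0"
    and "orthogonalizing_probability_measure (charlier 1 0 l) \<mu>"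
    and "semicircle_law l l \<nu>"
  shows "cfree_poisson l \<mu> \<nu>"
proof -
  \<comment> \<open>At \<open>t = 0\<close> the summand \<open>t ^ n\<close> survives only as
    \<open>0 ^ 0 = 1\<close>, which is why only the coefficient of index 1 differs.\<close>
  define a where "a k = (if k = 1 then l + 1 else l)" for k :: nat
  define b where "b k = (if k = 0 then 0 else l)" for k :: nat
  \<comment> \<open>This is the maximum of \<open>1 + \<bar>a k\<bar> + \<bar>b k\<bar>\<close>,
    attained at \<open>k = 1\<close>.\<close>
  define r where "r = 2 * l + 2"
  have \<mu>: "real_distribution \<mu>"
    using assms(2) by (simp add: orthogonalizing_probability_measure_def)
  interpret bounded_orthogonal_recurrence \<mu> "charlier 1 0 l" a b r
  proof (intro bounded_orthogonal_recurrence.intro bounded_orthogonal_recurrence_axioms.intro \<mu>)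
    show "charlier 1 0 l (Suc k) = [:- a k, 1:] * charlier 1 0 l k
        - smult (b k) (charlier 1 0 l (k - 1))" for k
    proof (cases k)
      case (Suc j)
      then show ?thesis by (cases j) (auto simp: a_def b_def)
    qed (simp add: a_def b_def)
  qed (use assms in \<open>auto simp: a_def b_def r_def\<close>)
  have \<nu>: "real_distribution \<nu>" and supp: "compactly_supported_distribution \<nu>"
    and ev: "\<forall>\<^sub>F z in at_infinity. 1 / cauchy_transform \<nu> z = z - (l + l * cauchy_transform \<nu> z)"
    using assms(3) by (auto simp: semicircle_law_def free_cumulant_series_def eval_fps_affine
        compactly_supported_distribution_def)
  obtain B where B: "AE x in \<nu>. \<bar>x\<bar> \<le> B"
    using supp by (auto simp: compactly_supported_distribution_iff)
  \<comment> \<open>The first threshold makes \<open>norm G\<close> at most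
    \<open>1 / (3 * r + 1)\<close>, so that \<open>1 / G\<close> beats the growth rate
    \<open>3 * r\<close>; the second gives \<open>norm z > 2 * r\<close> whatever the sign of
    \<open>B\<close>.\<close>
  have large: "\<forall>\<^sub>F z :: complex in at_infinity. norm z \<ge> B + 3 * r + 1"
              "\<forall>\<^sub>F z :: complex in at_infinity. norm z \<ge> 3 * r + 1"
    by (auto simp: eventually_at_infinity)
  have "\<forall>\<^sub>F z in at_infinity. 1 / cauchy_transform \<mu> z =
      z - eval_fps (Abs_fps (\<lambda>_. of_real l)) (cauchy_transform \<nu> z)"
    using ev large
  proof eventually_elim
    case (elim z)
    define G where "G = cauchy_transform \<nu> z"
    define Q where "Q k = second_kind k z" for k
    have r: "r > 2" "r > l" using assms(1) by (auto simp: r_def)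
    have z: "norm z > 2 * r" using elim r by linarith
    have "norm G \<le> 1 / (norm z - B)"
      unfolding G_def using elim r by (intro cauchy_transform_bound \<nu> B) linarith
    also have "\<dots> \<le> 1 / (3 * r + 1)"
      using elim r by (intro divide_left_mono) auto
    finally have G_small: "norm G \<le> 1 / (3 * r + 1)" .
    also have "\<dots> < 1" using r by simp
    finally have G_less: "norm G < 1" .
    have G_eq: "1 / G = z - l - l * G"
      using elim by (simp add: G_def algebra_simps)
    \<comment> \<open>As \<open>1 / 0 = 0\<close>, a vanishing \<open>G\<close> would turn
      \<open>G_eq\<close> into \<open>z = l\<close>, which is too small.\<close>
    have G0: "G \<noteq> 0"
    proof
      assume "G = 0"
      with G_eq have "norm z = l" using assms(1) by simp
      with z r show False by linarith
    qed
    have G1: "G \<noteq> 1" using G_less by auto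
    have Q_Suc: "Q (Suc k) = (z - a k) * Q k - b k * Q (k - 1) - (if k = 0 then 1 else 0)" for k
      unfolding Q_def by (rule second_kind_Suc[OF z])
    have Q1: "Q 1 = (z - l) * Q 0 - 1"
      using Q_Suc[of 0] by (simp add: a_def b_def)
    have Q2: "Q 2 = (z - l - 1) * Q 1 - l * Q 0"
      using Q_Suc[of 1] by (simp add: a_def b_def numeral_2_eq_2 algebra_simps)
    \<comment> \<open>The sequence starts at \<open>Q 1\<close> because the coefficients are
      constant only from there on. The roots \<open>l * G\<close> and \<open>1 / G\<close> have sum
      \<open>z - l\<close> and product \<open>l\<close>; the constant \<open>C\<close> absorbs the
      factor \<open>3 * r\<close> due to the shift.\<close>
    have "Q (Suc 1) = (l * G) * Q (Suc 0)"
    proof (rule recurrence_dominated_solution[where q = "\<lambda>k. Q (Suc k)" and v = "1 / G"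
          and s = "3 * r" and C = "3 * r / (norm z - 2 * r)"])
      fix k
      have "z - l = l * G + 1 / G" using G_eq by (simp add: algebra_simps)
      then show "Q (Suc (Suc (Suc k))) =
          (l * G + 1 / G) * Q (Suc (Suc k)) - l * G * (1 / G) * Q (Suc k)"
        using Q_Suc[of "Suc (Suc k)"] G0 by (simp add: a_def b_def)
      show "norm (Q (Suc k)) \<le> 3 * r / (norm z - 2 * r) * (3 * r) ^ k"
        using second_kind_bound[OF z, of "Suc k"] by (simp add: Q_def)
    next
      have "3 * r + 1 \<le> 1 / norm G"
        using G_small G0 r by (simp add: field_simps)
      then show "3 * r < norm (1 / G)" by (simp add: norm_divide)
    qed (use r in simp)
    then have "(z - l - l * G - 1) * Q 1 = l * Q 0"
      using Q2 by (simp add: numeral_2_eq_2 algebra_simps)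
    \<comment> \<open>By \<open>G_eq\<close> the coefficient of \<open>Q 1\<close> is
      \<open>1 / G - 1\<close>; both sides are then multiplied by \<open>G\<close>.\<close>
    then have "(1 - G) * Q 1 = l * G * Q 0"
      unfolding G_eq[symmetric] using G0 by (simp add: field_simps)
    then have Q1': "Q 1 = l * G / (1 - G) * Q 0"
      using G1 by (simp add: field_simps)
    \<comment> \<open>Equating the two expressions for \<open>Q 1\<close> leaves the coefficient
      \<open>z - l - l * G / (1 - G)\<close> of \<open>Q 0\<close>; the subtracted terms add up to
      \<open>l / (1 - G)\<close>, the sum of the series with all cumulants \<open>l\<close>.\<close>
    have one: "(z - l / (1 - G)) * Q 0 = 1"
    proof -
      have "l / (1 - G) = l + l * G / (1 - G)" using G1 by (simp add: field_simps)
      then show ?thesis using Q1 Q1' by (simp add: algebra_simps)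
    qed
    then have "Q 0 \<noteq> 0" by auto
    with one have "1 / Q 0 = z - l / (1 - G)"
      by (simp add: divide_eq_eq)
    then show ?case
      using G_less by (simp add: Q_def G_def second_kind_0 eval_fps_constant_coeffs)
  qed
  then have "cfree_cumulant_series \<mu> \<nu> (Abs_fps (\<lambda>_. of_real l))"
    using \<mu> AE_bounded supp fps_conv_radius_constant_coeffs_pos
    by (auto simp: cfree_cumulant_series_def compactly_supported_distribution_iff)
  then show ?thesis
    unfolding cfree_poisson_def by (intro exI conjI) auto
qed

end
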